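(* Let $G$ be a graph and let $\mathcal{P}_f(G)$ be its set of fractional perfect matchings, equipped with the metric $d(\gamma_1,\gamma_2)=\|\gamma_1-\gamma_2\|_1$. Then the function $f_G:\mathcal{P}_f(G)\to\mathbb{R}^{\ge 0}$, which assigns to $\gamma$ its fractional forcing number $f_G(\gamma)$, is continuous with respect to $d$.
   Context: Graphs are finite, simple and undirected: $V(G)$ is a finite set and $E(G)$ is a set of 2-element subsets of $V(G)$. A fractional matching of $G$ is a function $\alpha:E(G)\to\mathbb{R}^{\ge 0}$ with $\sum_{e\ni v}\alpha(e)\le 1$ for every $v\in V(G)$; it is a fractional perfect matching if equality holds at every $v$. $\mathcal{P}_f(G)$ denotes the set of all fractional perfect matchings of $G$. Write $\|\alpha\|_1=\sum_{e\in E(G)}|\alpha(e)|$, and $\alpha\preceq\gamma$ if $\alpha(e)\le\gamma(e)$ for all $e\in E(G)$. For a fractional matching $\alpha$ and $\gamma\in\mathcal{P}_f(G)$, write $\alpha\uparrow\gamma$ ($\alpha$ is a forcing function for $\gamma$) if $\alpha\preceq\gamma$ and $\gamma$ is the only element $\gamma'$ of $\mathcal{P}_f(G)$ with $\alpha\preceq\gamma'$. The fractional forcing number of $\gamma$ is $f_G(\gamma)=\inf\{\|\alpha\|_1:\alpha\uparrow\gamma\}$. *)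

theory Defs
  imports "HOL-Analysis.Analysis"
begin

definition simple_graph :: "'v set \<Rightarrow> 'v set set \<Rightarrow> bool" where
  "simple_graph V E \<longleftrightarrow> finite V \<and> (\<forall>e\<in>E. e \<subseteq> V \<and> card e = 2)"

(* Functions on E are total HOL functions normalised to "undefined" outside E
   (as expressed by \<rightarrow>\<^sub>E), so that HOL equality of two of them is
   equality on E; otherwise uniqueness would fail and d would only be a pseudometric. *)
definition fractional_matchings :: "'v set \<Rightarrow> 'v set set \<Rightarrow> ('v set \<Rightarrow> real) set" where
  "fractional_matchings V E =
     {\<alpha> \<in> E \<rightarrow>\<^sub>E {0..}. \<forall>v\<in>V. (\<Sum>e\<in>{e\<in>E. v \<in> e}. \<alpha> e) \<le> 1}"

definition fractional_perfect_matchings ::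
    "'v set \<Rightarrow> 'v set set \<Rightarrow> ('v set \<Rightarrow> real) set" where
  "fractional_perfect_matchings V E =
     {\<alpha> \<in> fractional_matchings V E. \<forall>v\<in>V. (\<Sum>e\<in>{e\<in>E. v \<in> e}. \<alpha> e) = 1}"

definition l1_norm :: "'v set set \<Rightarrow> ('v set \<Rightarrow> real) \<Rightarrow> real" where
  "l1_norm E \<alpha> = (\<Sum>e\<in>E. \<bar>\<alpha> e\<bar>)"

definition l1_dist :: "'v set set \<Rightarrow> ('v set \<Rightarrow> real) \<Rightarrow> ('v set \<Rightarrow> real) \<Rightarrow> real" where
  "l1_dist E \<gamma>1 \<gamma>2 = l1_norm E (\<lambda>e. \<gamma>1 e - \<gamma>2 e)"

definition fun_below :: "'v set set \<Rightarrow> ('v set \<Rightarrow> real) \<Rightarrow> ('v set \<Rightarrow> real) \<Rightarrow> bool" where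
  "fun_below E \<alpha> \<gamma> \<longleftrightarrow> (\<forall>e\<in>E. \<alpha> e \<le> \<gamma> e)"

definition forcing_function ::
    "'v set \<Rightarrow> 'v set set \<Rightarrow> ('v set \<Rightarrow> real) \<Rightarrow> ('v set \<Rightarrow> real) \<Rightarrow> bool" where
  "forcing_function V E \<alpha> \<gamma> \<longleftrightarrow>
     \<alpha> \<in> fractional_matchings V E \<and> \<gamma> \<in> fractional_perfect_matchings V E \<and>
     fun_below E \<alpha> \<gamma> \<and>
     (\<forall>\<gamma>'\<in>fractional_perfect_matchings V E. fun_below E \<alpha> \<gamma>' \<longrightarrow> \<gamma>' = \<gamma>)"

(* For a fractional perfect matching the infimum is over a set bounded below by 0
   that contains the norm of the matching itself, so the real-valued Inf is the true infimum. *)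
definition fractional_forcing_number ::
    "'v set \<Rightarrow> 'v set set \<Rightarrow> ('v set \<Rightarrow> real) \<Rightarrow> real" where
  "fractional_forcing_number V E \<gamma> = Inf {l1_norm E \<alpha> | \<alpha>. forcing_function V E \<alpha> \<gamma>}"

lemma finite_edges:
  assumes "simple_graph V E"
  shows "finite E"
  using assms unfolding simple_graph_def
  by (meson PowI finite_Pow_iff finite_subset subsetI)

lemma forcing_function_self:
  assumes "simple_graph V E" and "\<gamma> \<in> fractional_perfect_matchings V E"
  shows "forcing_function V E \<gamma> \<gamma>"
proof -
  have fE: "finite E" using assms(1) by (rule finite_edges)
  have "\<gamma>' = \<gamma>" if g': "\<gamma>' \<in> fractional_perfect_matchings V E" and le: "fun_below E \<gamma> \<gamma>'" for \<gamma>'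
  proof (rule extensionalityI[of _ E])
    show "\<gamma>' \<in> extensional E" "\<gamma> \<in> extensional E"
      using g' assms(2)
      by (auto simp: fractional_perfect_matchings_def fractional_matchings_def PiE_def)
    fix e assume e: "e \<in> E"
    then have "card e = 2" "e \<subseteq> V" using assms(1) by (auto simp: simple_graph_def)
    then obtain v where v: "v \<in> e" "v \<in> V" by (auto simp: card_2_iff)
    let ?I = "{e \<in> E. v \<in> e}"
    have "(\<Sum>e\<in>?I. \<gamma>' e - \<gamma> e) = 0"
      using g' assms(2) v(2) by (simp add: sum_subtractf fractional_perfect_matchings_def)
    moreover have "finite ?I" using fE by simp
    moreover have "\<gamma>' x - \<gamma> x \<ge> 0" if "x \<in> ?I" for x
      using le that by (simp add: fun_below_def)
    ultimately have "\<forall>x\<in>?I. \<gamma>' x - \<gamma> x = 0"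
      by (subst (asm) sum_nonneg_eq_0_iff) auto
    then show "\<gamma>' e = \<gamma> e" using e v(1) by auto
  qed
  then show ?thesis
    using assms(2) by (auto simp: forcing_function_def fun_below_def fractional_perfect_matchings_def)
qed

lemma Metric_space_fractional_perfect_matchings:
  assumes "simple_graph V E"
  shows "Metric_space (fractional_perfect_matchings V E) (l1_dist E)"
proof
  have fE: "finite E" using assms by (rule finite_edges)
  fix x y z :: "'a set \<Rightarrow> real"
  show "0 \<le> l1_dist E x y"
    by (simp add: l1_dist_def l1_norm_def sum_nonneg)
  show "l1_dist E x y = l1_dist E y x"
    by (simp add: l1_dist_def l1_norm_def abs_minus_commute)
  show "l1_dist E x z \<le> l1_dist E x y + l1_dist E y z"
    unfolding l1_dist_def l1_norm_def sum.distrib[symmetric] by (rule sum_mono) auto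
  assume "x \<in> fractional_perfect_matchings V E" "y \<in> fractional_perfect_matchings V E"
  then have "x \<in> extensional E" "y \<in> extensional E"
    by (auto simp: fractional_perfect_matchings_def fractional_matchings_def PiE_def)
  then show "l1_dist E x y = 0 \<longleftrightarrow> x = y"
    unfolding l1_dist_def l1_norm_def using fE
    by (auto simp: sum_nonneg_eq_0_iff intro: extensionalityI)
qed

end

theory Submission
  imports Defs
begin

text \<open>
  Whether \<open>\<alpha>\<close> forces \<open>\<gamma>\<close> depends only on the set of edges where \<open>\<alpha>\<close> is strictly below \<open>\<gamma>\<close>.
  Two fractional perfect matchings differ by a function \<open>\<delta>\<close> whose sum at every vertex is \<open>0\<close>;
  conversely, if such a \<open>\<delta>\<close> is negative only where \<open>\<alpha> < \<gamma>\<close>, then \<open>\<gamma> + t \<delta>\<close> still lies above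
  \<open>\<alpha>\<close> for small \<open>t > 0\<close>.  So \<open>\<alpha>\<close> forces \<open>\<gamma>\<close> exactly when no nonzero \<open>\<delta>\<close> has all its negative
  values inside that slack set, a condition in which \<open>\<gamma>\<close> itself does not occur.

  A slack set \<open>S\<close> of one matching \<open>\<gamma>1\<close> can therefore be reused for any other matching \<open>\<gamma>2\<close>:
  the function that is \<open>0\<close> on \<open>S\<close> and \<open>\<gamma>2\<close> off \<open>S\<close> forces \<open>\<gamma>2\<close>.  Its norm is the weight of \<open>\<gamma>2\<close>
  off \<open>S\<close>, which exceeds that of \<open>\<gamma>1\<close> off \<open>S\<close> by at most the distance of the two matchings, and
  the latter weight is at most the norm of any forcing function of \<open>\<gamma>1\<close> with slack set \<open>S\<close>.
  Hence the fractional forcing number is even 1-Lipschitz.  (It is the minimum, over the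
  finitely many admissible \<open>S\<close>, of the linear functionals ``weight off \<open>S\<close>''.)
\<close>

definition balanced :: "'v set \<Rightarrow> 'v set set \<Rightarrow> ('v set \<Rightarrow> real) \<Rightarrow> bool" where
  "balanced V E \<delta> \<longleftrightarrow> (\<forall>v\<in>V. (\<Sum>e\<in>{e\<in>E. v \<in> e}. \<delta> e) = 0)"

text \<open>
  The sets on which a forcing function may drop below the matching that it forces.
\<close>

definition admissible_slack :: "'v set \<Rightarrow> 'v set set \<Rightarrow> 'v set set \<Rightarrow> bool" where
  "admissible_slack V E S \<longleftrightarrow>
     (\<forall>\<delta>. balanced V E \<delta> \<longrightarrow> (\<forall>e\<in>E - S. 0 \<le> \<delta> e) \<longrightarrow> (\<forall>e\<in>E. \<delta> e = 0))"

lemma fractional_perfect_matching_iff: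
  "\<gamma> \<in> fractional_perfect_matchings V E \<longleftrightarrow>
     \<gamma> \<in> extensional E \<and> (\<forall>e\<in>E. 0 \<le> \<gamma> e) \<and> (\<forall>v\<in>V. (\<Sum>e\<in>{e\<in>E. v \<in> e}. \<gamma> e) = 1)"
  by (auto simp: fractional_perfect_matchings_def fractional_matchings_def PiE_iff)

lemma balanced_diff:
  assumes "\<gamma> \<in> fractional_perfect_matchings V E" "\<gamma>' \<in> fractional_perfect_matchings V E"
  shows "balanced V E (\<lambda>e. \<gamma>' e - \<gamma> e)"
  using assms by (simp add: balanced_def fractional_perfect_matching_iff sum_subtractf)

lemma exists_scale_above_slack:
  fixes \<delta> s :: "'a \<Rightarrow> real"
  assumes "finite S" "\<And>e. e \<in> S \<Longrightarrow> 0 < s e"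
  shows "\<exists>t>0. \<forall>e\<in>S. - s e \<le> t * \<delta> e"
proof -
  have "\<forall>\<^sub>F t in at_right 0. - s e < t * \<delta> e" if "e \<in> S" for e
  proof (rule order_tendstoD(1))
    show "((\<lambda>t. t * \<delta> e) \<longlongrightarrow> 0 * \<delta> e) (at_right 0)" by (intro tendsto_intros)
    show "- s e < 0 * \<delta> e" using assms(2)[OF that] by simp
  qed
  then have "\<forall>\<^sub>F t in at_right 0. \<forall>e\<in>S. - s e < t * \<delta> e"
    using assms(1) by (simp add: eventually_ball_finite_distrib)
  then have "\<forall>\<^sub>F t in at_right 0. (0::real) < t \<and> (\<forall>e\<in>S. - s e < t * \<delta> e)"
    using eventually_at_right_less[of "0::real"] by eventually_elim simp
  then obtain t where "0 < t" "\<forall>e\<in>S. - s e < t * \<delta> e"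
    using eventually_happens'[OF trivial_limit_at_right_real] by blast
  then show ?thesis by (meson less_imp_le)
qed

text \<open>
  A nonzero balanced \<open>\<delta>\<close> that is negative only inside the slack set would allow \<open>\<gamma>\<close> to be moved a
  little in direction \<open>\<delta>\<close> while staying above \<open>\<alpha>\<close>, contradicting uniqueness.
\<close>

lemma admissible_slack_of_forcing:
  assumes "finite E" and forcing: "forcing_function V E \<alpha> \<gamma>"
  shows "admissible_slack V E {e\<in>E. \<alpha> e < \<gamma> e}"
  unfolding admissible_slack_def
proof (intro allI impI)
  fix \<delta> assume bal: "balanced V E \<delta>"
    and nonneg: "\<forall>e\<in>E - {e\<in>E. \<alpha> e < \<gamma> e}. 0 \<le> \<delta> e"
  have \<gamma>: "\<gamma> \<in> fractional_perfect_matchings V E"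
    and below: "\<And>e. e \<in> E \<Longrightarrow> \<alpha> e \<le> \<gamma> e"
    and \<alpha>: "\<And>e. e \<in> E \<Longrightarrow> 0 \<le> \<alpha> e"
    using forcing
    by (auto simp: forcing_function_def fun_below_def fractional_matchings_def)
  obtain t where t: "0 < t"
    and slack: "\<And>e. e \<in> E \<Longrightarrow> \<alpha> e < \<gamma> e \<Longrightarrow> - (\<gamma> e - \<alpha> e) \<le> t * \<delta> e"
    using exists_scale_above_slack[of "{e\<in>E. \<alpha> e < \<gamma> e}" "\<lambda>e. \<gamma> e - \<alpha> e" \<delta>] assms(1)
    by auto
  define \<gamma>' where "\<gamma>' = restrict (\<lambda>e. \<gamma> e + t * \<delta> e) E"
  have above: "\<alpha> e \<le> \<gamma>' e" if "e \<in> E" for e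
  proof (cases "\<alpha> e < \<gamma> e")
    case True
    then show ?thesis using slack[OF that True] that by (simp add: \<gamma>'_def)
  next
    case False
    then have "0 \<le> t * \<delta> e" using nonneg t that by simp
    then show ?thesis using below[OF that] that by (simp add: \<gamma>'_def)
  qed
  have "\<gamma>' \<in> fractional_perfect_matchings V E"
    unfolding fractional_perfect_matching_iff
  proof (intro conjI ballI)
    show "\<gamma>' \<in> extensional E" by (simp add: \<gamma>'_def)
    show "0 \<le> \<gamma>' e" if "e \<in> E" for e using above[OF that] \<alpha>[OF that] by linarith
    fix v assume "v \<in> V"
    have "(\<Sum>e\<in>{e\<in>E. v \<in> e}. \<gamma>' e) = (\<Sum>e\<in>{e\<in>E. v \<in> e}. \<gamma> e + t * \<delta> e)"
      by (rule sum.cong) (auto simp: \<gamma>'_def)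
    also have "\<dots> = 1"
      using \<gamma> bal \<open>v \<in> V\<close>
      by (simp add: sum.distrib sum_distrib_left[symmetric] balanced_def
          fractional_perfect_matching_iff)
    finally show "(\<Sum>e\<in>{e\<in>E. v \<in> e}. \<gamma>' e) = 1" .
  qed
  then have "\<gamma>' = \<gamma>"
    using forcing above by (auto simp: forcing_function_def fun_below_def)
  then have "\<gamma> e + t * \<delta> e = \<gamma> e" if "e \<in> E" for e
    using that by (metis \<gamma>'_def restrict_apply')
  then show "\<forall>e\<in>E. \<delta> e = 0" using t by simp
qed

text \<open>
  The truncation is the smallest nonnegative function that agrees with \<open>\<gamma>\<close> off \<open>S\<close>.  Every fractional
  perfect matching above it differs from \<open>\<gamma>\<close> by a balanced function that is nonnegative off
  \<open>S\<close>, and admissibility makes that function vanish.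
\<close>

lemma forcing_function_truncation:
  assumes S: "admissible_slack V E S"
    and \<gamma>: "\<gamma> \<in> fractional_perfect_matchings V E"
  shows "forcing_function V E (restrict (\<lambda>e. if e \<in> S then 0 else \<gamma> e) E) \<gamma>"
    (is "forcing_function V E ?\<alpha> \<gamma>")
proof -
  have nonneg: "\<And>e. e \<in> E \<Longrightarrow> 0 \<le> \<gamma> e"
    using \<gamma> by (simp add: fractional_perfect_matching_iff)
  have "(\<Sum>e\<in>{e\<in>E. v \<in> e}. ?\<alpha> e) \<le> 1" if "v \<in> V" for v
  proof -
    have "(\<Sum>e\<in>{e\<in>E. v \<in> e}. ?\<alpha> e) \<le> (\<Sum>e\<in>{e\<in>E. v \<in> e}. \<gamma> e)"
      by (rule sum_mono) (auto simp: nonneg)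
    then show ?thesis using \<gamma> that by (simp add: fractional_perfect_matching_iff)
  qed
  then have "?\<alpha> \<in> fractional_matchings V E"
    by (auto simp: fractional_matchings_def nonneg)
  moreover have "fun_below E ?\<alpha> \<gamma>" by (simp add: fun_below_def nonneg)
  moreover have "\<gamma>' = \<gamma>"
    if \<gamma>': "\<gamma>' \<in> fractional_perfect_matchings V E" and above: "fun_below E ?\<alpha> \<gamma>'" for \<gamma>'
  proof (rule extensionalityI[of _ E])
    show "\<gamma>' \<in> extensional E" "\<gamma> \<in> extensional E"
      using \<gamma> \<gamma>' by (simp_all add: fractional_perfect_matching_iff)
    have "\<forall>e\<in>E - S. 0 \<le> \<gamma>' e - \<gamma> e"
      using above by (auto simp: fun_below_def split: if_splits)
    then have "\<forall>e\<in>E. \<gamma>' e - \<gamma> e = 0"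
      using S balanced_diff[OF \<gamma> \<gamma>'] unfolding admissible_slack_def by blast
    then show "\<gamma>' e = \<gamma> e" if "e \<in> E" for e using that by simp
  qed
  ultimately show ?thesis using \<gamma> by (simp add: forcing_function_def)
qed

lemma l1_norm_nonneg: "0 \<le> l1_norm E \<alpha>"
  by (simp add: l1_norm_def sum_nonneg)

lemma fractional_forcing_number_le:
  assumes "forcing_function V E \<alpha> \<gamma>"
  shows "fractional_forcing_number V E \<gamma> \<le> l1_norm E \<alpha>"
  unfolding fractional_forcing_number_def
  by (rule cInf_lower) (use assms in \<open>auto intro!: bdd_belowI[of _ 0] l1_norm_nonneg\<close>)

lemma le_fractional_forcing_number:
  assumes "simple_graph V E" "\<gamma> \<in> fractional_perfect_matchings V E"
    and "\<And>\<alpha>. forcing_function V E \<alpha> \<gamma> \<Longrightarrow> c \<le> l1_norm E \<alpha>"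
  shows "c \<le> fractional_forcing_number V E \<gamma>"
  unfolding fractional_forcing_number_def
  by (rule cInf_greatest) (use assms forcing_function_self in blast)+

text \<open>
  Truncating \<open>\<gamma>2\<close> on the slack set of a forcing function of \<open>\<gamma>1\<close> forces \<open>\<gamma>2\<close>.  The norms
  compare edge by edge: the truncation is \<open>0\<close> on the slack set, and off it the forcing function
  equals \<open>\<gamma>1\<close>.
\<close>

lemma fractional_forcing_number_Lipschitz:
  assumes G: "simple_graph V E"
    and \<gamma>1: "\<gamma>1 \<in> fractional_perfect_matchings V E"
    and \<gamma>2: "\<gamma>2 \<in> fractional_perfect_matchings V E"
  shows "fractional_forcing_number V E \<gamma>2 \<le> fractional_forcing_number V E \<gamma>1 + l1_dist E \<gamma>1 \<gamma>2"
proof -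
  have fin: "finite E" using G by (rule finite_edges)
  have "fractional_forcing_number V E \<gamma>2 - l1_dist E \<gamma>1 \<gamma>2 \<le> l1_norm E \<alpha>"
    if forcing: "forcing_function V E \<alpha> \<gamma>1" for \<alpha>
  proof -
    let ?S = "{e\<in>E. \<alpha> e < \<gamma>1 e}"
    let ?\<beta> = "restrict (\<lambda>e. if e \<in> ?S then 0 else \<gamma>2 e) E"
    have "forcing_function V E ?\<beta> \<gamma>2"
      by (intro forcing_function_truncation admissible_slack_of_forcing fin forcing \<gamma>2)
    then have "fractional_forcing_number V E \<gamma>2 \<le> l1_norm E ?\<beta>"
      by (rule fractional_forcing_number_le)
    also have "\<dots> \<le> l1_norm E \<alpha> + l1_dist E \<gamma>1 \<gamma>2"
      unfolding l1_norm_def l1_dist_def sum.distrib[symmetric]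
    proof (rule sum_mono)
      fix e assume "e \<in> E"
      then have "\<alpha> e \<le> \<gamma>1 e" using forcing by (simp add: forcing_function_def fun_below_def)
      with \<open>e \<in> E\<close> show "\<bar>?\<beta> e\<bar> \<le> \<bar>\<alpha> e\<bar> + \<bar>\<gamma>1 e - \<gamma>2 e\<bar>" by auto
    qed
    finally show ?thesis by simp
  qed
  from le_fractional_forcing_number[OF G \<gamma>1 this] show ?thesis by simp
qed

theorem theorem3p10:
  fixes V :: "'v set" and E :: "'v set set"
  assumes "simple_graph V E"
  shows "continuous_map
           (Metric_space.mtopology (fractional_perfect_matchings V E) (l1_dist E))
           (top_of_set {0::real..})
           (fractional_forcing_number V E)"
proof -
  let ?P = "fractional_perfect_matchings V E" and ?f = "fractional_forcing_number V E"
  interpret M: Metric_space ?P "l1_dist E"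
    using assms by (rule Metric_space_fractional_perfect_matchings)
  have close: "\<bar>?f \<gamma>2 - ?f \<gamma>1\<bar> \<le> l1_dist E \<gamma>1 \<gamma>2" if "\<gamma>1 \<in> ?P" "\<gamma>2 \<in> ?P" for \<gamma>1 \<gamma>2
    using fractional_forcing_number_Lipschitz[OF assms that]
      fractional_forcing_number_Lipschitz[OF assms that(2,1)] M.commute[of \<gamma>1 \<gamma>2]
    by linarith
  have "continuous_map M.mtopology Met_TC.mtopology ?f"
    unfolding Met_TC.continuous_map_to_metric
  proof (intro ballI allI impI)
    fix \<gamma> and \<epsilon> :: real assume "\<gamma> \<in> topspace M.mtopology" "0 < \<epsilon>"
    then have \<gamma>: "\<gamma> \<in> ?P" by simp
    have "?f \<gamma>' \<in> Met_TC.mball (?f \<gamma>) \<epsilon>" if "\<gamma>' \<in> M.mball \<gamma> \<epsilon>" for \<gamma>'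
      using that close[OF \<gamma>, of \<gamma>'] by (auto simp: dist_real_def)
    then show "\<exists>U. openin M.mtopology U \<and> \<gamma> \<in> U \<and> (\<forall>y\<in>U. ?f y \<in> Met_TC.mball (?f \<gamma>) \<epsilon>)"
      using \<gamma> \<open>0 < \<epsilon>\<close> by (meson M.centre_in_mball_iff M.openin_mball)
  qed
  then have "continuous_map M.mtopology euclidean ?f" by simp
  moreover have "0 \<le> ?f \<gamma>" if "\<gamma> \<in> ?P" for \<gamma>
    using assms that by (intro le_fractional_forcing_number l1_norm_nonneg)
  ultimately show ?thesis by (auto simp: continuous_map_in_subtopology)
qed

end
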